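(* Let $U$ be a unital of order $n \ge 2$ and let $G_{\overline{U}}$ be its non-incidence graph. Then \[ i(G_{\overline{U}}) = \begin{cases} \frac{4}{5}, & \text{ if } n=2,\\ \frac{2(n^3+1)}{n^2(n^2+1)}, & \text{ if } n \ge 3. \end{cases} \]
   Context: A unital of order $n\ge 2$ is a $2$-$(n^3+1,n+1,1)$ design $(P,\mathcal{B})$: $P$ is a set of $n^3+1$ points, $\mathcal{B}$ a set of $(n+1)$-subsets (lines) such that every two points lie on exactly one line. The non-incidence graph $G_{\overline{U}}$ is the bipartite graph on vertex set $P\cup\mathcal{B}$ in which a point $p$ is adjacent to a block $B$ iff $p\notin B$. For a graph $G$ and $S\subseteq V(G)$, $N(S)$ is the set of vertices outside $S$ adjacent to some vertex of $S$, and $i(G)=\min\{|N(S)|/|S| : \emptyset\ne S\subseteq V(G),\ |S|\le |V(G)|/2\}$. *)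

theory Defs
  imports Complex_Main "Graph_Theory.Pair_Digraph"
begin

text \<open>
  Blocks form a set, so repeated blocks are excluded. The quantification is over
  pairs of distinct points.
\<close>

definition design2 :: "nat \<Rightarrow> nat \<Rightarrow> nat \<Rightarrow> 'a set \<Rightarrow> 'a set set \<Rightarrow> bool" where
  "design2 v k l P \<B> \<longleftrightarrow>
     finite P \<and> card P = v \<and>
     (\<forall>B\<in>\<B>. B \<subseteq> P \<and> card B = k) \<and>
     (\<forall>x\<in>P. \<forall>y\<in>P. x \<noteq> y \<longrightarrow> card {B \<in> \<B>. x \<in> B \<and> y \<in> B} = l)"

definition unital :: "nat \<Rightarrow> 'a set \<Rightarrow> 'a set set \<Rightarrow> bool" where
  "unital n P \<B> \<longleftrightarrow> n \<ge> 2 \<and> design2 (n ^ 3 + 1) (n + 1) 1 P \<B>"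

text \<open>
  Undirected graphs are symmetric loop-free digraphs, as in the locale
  \<^locale>\<open>pair_graph\<close>. The vertex set is the disjoint union of points
  (tagged \<^const>\<open>Inl\<close>) and blocks (tagged \<^const>\<open>Inr\<close>);
  each edge is represented by its two arcs.
\<close>

definition non_incidence_graph :: "'a set \<Rightarrow> 'a set set \<Rightarrow> ('a + 'a set) pair_pre_digraph" where
  "non_incidence_graph P \<B> =
     \<lparr> pverts = Inl ` P \<union> Inr ` \<B>,
       parcs = {(Inl p, Inr B) | p B. p \<in> P \<and> B \<in> \<B> \<and> p \<notin> B}
             \<union> {(Inr B, Inl p) | p B. p \<in> P \<and> B \<in> \<B> \<and> p \<notin> B} \<rparr>"

definition nbhd :: "'v pair_pre_digraph \<Rightarrow> 'v set \<Rightarrow> 'v set" where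
  "nbhd G S = {v \<in> pverts G - S. \<exists>u\<in>S. (u, v) \<in> parcs G}"

text \<open>
  Meaningful for finite graphs with at least two vertices: then the minimum
  is over a finite nonempty set.
\<close>

definition isoperimetric_number :: "'v pair_pre_digraph \<Rightarrow> real" where
  "isoperimetric_number G =
     Min {real (card (nbhd G S)) / real (card S) | S.
            S \<noteq> {} \<and> S \<subseteq> pverts G \<and> real (card S) \<le> real (card (pverts G)) / 2}"

lemma pair_graph_non_incidence_graph:
  assumes "finite P" and "\<And>B. B \<in> \<B> \<Longrightarrow> B \<subseteq> P"
  shows "pair_graph (non_incidence_graph P \<B>)"
proof -
  let ?G = "non_incidence_graph P \<B>"
  have fB: "finite \<B>"
    using assms by (meson Pow_iff finite_Pow_iff finite_subset subsetI)
  have fV: "finite (pverts ?G)"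
    using fB assms(1) by (simp add: non_incidence_graph_def)
  have sub: "parcs ?G \<subseteq> pverts ?G \<times> pverts ?G"
    by (auto simp: non_incidence_graph_def)
  have fE: "finite (parcs ?G)"
    using sub fV by (meson finite_SigmaI finite_subset)
  show ?thesis
  proof
    show "\<And>e. e \<in> parcs ?G \<Longrightarrow> fst e \<in> pverts ?G"
      and "\<And>e. e \<in> parcs ?G \<Longrightarrow> snd e \<in> pverts ?G"
      using sub by auto
    show "finite (pverts ?G)" by (fact fV)
    show "finite (parcs ?G)" by (fact fE)
    show "\<And>e. e \<in> parcs ?G \<Longrightarrow> fst e \<noteq> snd e"
      by (auto simp: non_incidence_graph_def)
    show "symmetric (with_proj ?G)"
      by (auto simp: symmetric_def sym_def non_incidence_graph_def)
  qed
qed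

lemma isoperimetric_number_ratios:
  assumes "finite (pverts G)" and "card (pverts G) \<ge> 2"
  defines "R \<equiv> {real (card (nbhd G S)) / real (card S) | S.
            S \<noteq> {} \<and> S \<subseteq> pverts G \<and> real (card S) \<le> real (card (pverts G)) / 2}"
  shows "finite R" and "R \<noteq> {}"
proof -
  have "R \<subseteq> (\<lambda>S. real (card (nbhd G S)) / real (card S)) ` Pow (pverts G)"
    unfolding R_def by auto
  then show "finite R"
    using assms(1) by (meson finite_Pow_iff finite_imageI finite_subset)
  from assms(2) obtain v where "v \<in> pverts G" by fastforce
  then have "real (card (nbhd G {v})) / real (card {v}) \<in> R"
    unfolding R_def using assms(2) by (auto intro!: exI[of _ "{v}"])
  then show "R \<noteq> {}" by blast
qed

end

(* Write S as X points and Y blocks, and let C be the set of points on all blocks of Y and D the set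
   of blocks containing X. Then N(S) consists of the points outside X and C and of the blocks outside
   Y and D. There are 2 M + 1 vertices, where 2 M = n^4 + n^2. As soon as Y has two blocks, C has at
   most one point, and as soon as X has two points, D has at most one block. Hence N(S) has at least
   |P| elements or at least |S| elements, with a single exception: n = 2, where X is a point p and Y
   contains the blocks avoiding p, and N(S) can be as small as |P| - 1. The minimum is attained by M
   blocks for n > 2 and by an exceptional set of M vertices for n = 2. *)
theory Submission
  imports Defs
begin

section \<open>Counting in 2-designs\<close>

lemma design2_finite_blocks:
  assumes "design2 v k l P \<B>"
  shows "finite \<B>"
proof (rule finite_subset)
  show "\<B> \<subseteq> Pow P" using assms by (auto simp: design2_def)
  show "finite (Pow P)" using assms by (simp add: design2_def)
qed

text \<open>Double count the pairs (\<open>y\<close>, \<open>B\<close>) with \<open>y\<close>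
  different from \<open>x\<close> and both on \<open>B\<close>: each \<open>y\<close> lies in
  \<open>l\<close> of them, each block through \<open>x\<close> in \<open>k - 1\<close>.\<close>

lemma design2_replication:
  assumes "design2 v k l P \<B>" "x \<in> P"
  shows "card {B \<in> \<B>. x \<in> B} * (k - 1) = (v - 1) * l"
proof -
  have fP: "finite P" and cP: "card P = v"
    and bl: "\<And>B. B \<in> \<B> \<Longrightarrow> B \<subseteq> P \<and> card B = k"
    and pr: "\<And>y. y \<in> P \<Longrightarrow> y \<noteq> x \<Longrightarrow> card {B \<in> \<B>. x \<in> B \<and> y \<in> B} = l"
    using assms by (auto simp: design2_def)
  have fB: "finite \<B>" by (rule design2_finite_blocks[OF assms(1)])
  have "(\<Sum>y\<in>P - {x}. card {B \<in> {B \<in> \<B>. x \<in> B}. y \<in> B}) = (\<Sum>B\<in>{B \<in> \<B>. x \<in> B}. k - 1)"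
  proof (rule sum_multicount_gen, safe)
    fix B assume B: "B \<in> \<B>" "x \<in> B"
    then have "{y \<in> P - {x}. y \<in> B} = B - {x}" using bl by auto
    then show "card {y \<in> P - {x}. y \<in> B} = k - 1" using bl B by simp
  qed (use fP fB in auto)
  moreover have "card {B \<in> {B \<in> \<B>. x \<in> B}. y \<in> B} = l" if "y \<in> P - {x}" for y
    using pr[of y] that by (simp add: conj_assoc)
  ultimately show ?thesis using cP assms(2) by simp
qed

lemma design2_flag_count:
  assumes "design2 v k l P \<B>" "\<And>x. x \<in> P \<Longrightarrow> card {B \<in> \<B>. x \<in> B} = r"
  shows "card \<B> * k = v * r"
proof -
  have fP: "finite P" and cP: "card P = v"
    and bl: "\<And>B. B \<in> \<B> \<Longrightarrow> B \<subseteq> P \<and> card B = k"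
    using assms by (auto simp: design2_def)
  have "(\<Sum>x\<in>P. card {B \<in> \<B>. x \<in> B}) = (\<Sum>B\<in>\<B>. k)"
  proof (rule sum_multicount_gen, safe)
    fix B assume "B \<in> \<B>"
    then have "{x \<in> P. x \<in> B} = B" "card B = k" using bl by auto
    then show "card {x \<in> P. x \<in> B} = k" by simp
  qed (use fP design2_finite_blocks[OF assms(1)] in auto)
  then show ?thesis using assms(2) cP by simp
qed

lemma linear_space_blocks_through_pair:
  assumes "design2 v k 1 P \<B>" "X \<subseteq> P" "card X \<ge> 2"
  shows "card {B \<in> \<B>. X \<subseteq> B} \<le> 1"
proof -
  obtain x y where xy: "x \<in> X" "y \<in> X" "x \<noteq> y"
    using assms(3) by (metis card_2_iff' obtain_subset_with_card_n subsetD)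
  have "card {B \<in> \<B>. X \<subseteq> B} \<le> card {B \<in> \<B>. x \<in> B \<and> y \<in> B}"
    using xy design2_finite_blocks[OF assms(1)] by (intro card_mono) auto
  also have "\<dots> = 1" using assms(1) subsetD[OF assms(2)] xy by (simp add: design2_def)
  finally show ?thesis .
qed

text \<open>Dual of the preceding bound: two common points would lie together on every block of
  \<open>Y\<close>, hence on at least two blocks.\<close>

lemma linear_space_points_on_pair:
  assumes "design2 v k 1 P \<B>" "Y \<subseteq> \<B>" "card Y \<ge> 2"
  shows "card {p \<in> P. \<forall>B\<in>Y. p \<in> B} \<le> 1"
proof (rule ccontr)
  let ?C = "{p \<in> P. \<forall>B\<in>Y. p \<in> B}"
  assume "\<not> card ?C \<le> 1"
  then have "card {B \<in> \<B>. ?C \<subseteq> B} \<le> 1"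
    by (intro linear_space_blocks_through_pair[OF assms(1)]) auto
  moreover have "card Y \<le> card {B \<in> \<B>. ?C \<subseteq> B}"
    using assms(2) design2_finite_blocks[OF assms(1)] by (intro card_mono) auto
  ultimately show False using assms(3) by simp
qed

lemma unital_replication:
  assumes "unital n P \<B>" "x \<in> P"
  shows "card {B \<in> \<B>. x \<in> B} = n ^ 2"
proof -
  have "n \<ge> 2" "design2 (n ^ 3 + 1) (n + 1) 1 P \<B>" using assms(1) by (auto simp: unital_def)
  with design2_replication[OF this(2) assms(2)] show ?thesis
    by (simp add: power2_eq_square power3_eq_cube)
qed

text \<open>Flag counting gives n^2 (n^2 - n + 1) blocks; \<open>n ^ 3\<close> stands on the left to
  avoid truncated subtraction.\<close>

lemma unital_card_blocks:
  assumes "unital n P \<B>"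
  shows "card \<B> + n ^ 3 = n ^ 4 + n ^ 2"
proof -
  have d: "design2 (n ^ 3 + 1) (n + 1) 1 P \<B>" using assms by (auto simp: unital_def)
  have "card \<B> * (n + 1) = (n ^ 3 + 1) * n ^ 2"
    by (rule design2_flag_count[OF d]) (rule unital_replication[OF assms])
  then have "(card \<B> + n ^ 3) * (n + 1) = (n ^ 4 + n ^ 2) * (n + 1)"
    by (simp add: algebra_simps power2_eq_square power3_eq_cube power4_eq_xxxx)
  then show ?thesis by (subst (asm) mult_right_cancel) simp_all
qed

text \<open>\<open>Y\<close> is part of the pencil of \<open>p\<close>. In contrapositive form: more
  than \<open>n ^ 2\<close> blocks have no common point.\<close>

lemma unital_common_points_few_blocks:
  assumes "unital n P \<B>" "Y \<subseteq> \<B>" "p \<in> P" "\<forall>B\<in>Y. p \<in> B"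
  shows "card Y \<le> n ^ 2"
proof -
  have "finite \<B>" using assms(1) design2_finite_blocks by (auto simp: unital_def)
  then have "card Y \<le> card {B \<in> \<B>. p \<in> B}" using assms(2,4) by (intro card_mono) auto
  then show ?thesis using unital_replication[OF assms(1,3)] by simp
qed

section \<open>Neighbourhoods in the non-incidence graph\<close>

text \<open>A point has no neighbour in \<open>Y\<close> exactly when it lies on all blocks of
  \<open>Y\<close>; dually, a block has none in \<open>X\<close> exactly when it contains
  \<open>X\<close>.\<close>

lemma nbhd_non_incidence_graph:
  assumes "X \<subseteq> P" "Y \<subseteq> \<B>"
  shows "nbhd (non_incidence_graph P \<B>) (Inl ` X \<union> Inr ` Y) =
    Inl ` (P - (X \<union> {p \<in> P. \<forall>B\<in>Y. p \<in> B})) \<union> Inr ` (\<B> - (Y \<union> {B \<in> \<B>. X \<subseteq> B}))"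
  using assms by (auto simp: nbhd_def non_incidence_graph_def bex_Un)

lemma card_Plus_image:
  assumes "finite A" "finite B"
  shows "card (Inl ` A \<union> Inr ` B) = card A + card B"
  using card_Plus[OF assms] by (simp add: Plus_def)

lemma card_nbhd_non_incidence_graph:
  assumes "finite P" "finite \<B>" "X \<subseteq> P" "Y \<subseteq> \<B>"
  shows "card (nbhd (non_incidence_graph P \<B>) (Inl ` X \<union> Inr ` Y)) =
    card (P - (X \<union> {p \<in> P. \<forall>B\<in>Y. p \<in> B})) + card (\<B> - (Y \<union> {B \<in> \<B>. X \<subseteq> B}))"
  unfolding nbhd_non_incidence_graph[OF assms(3,4)] using assms(1,2)
  by (intro card_Plus_image) auto

text \<open>As \<open>S\<close> has at most \<open>M\<close> elements, the alternatives bound the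
  ratio below by 1, by (n^3 + 1)/M and by 8/10. The cases are sizes 0, 1 and at least 2 of
  \<open>X\<close>, then of \<open>Y\<close>, since only a side with fewer than two elements lets
  \<open>?C\<close> or \<open>?D\<close> be large.\<close>

lemma unital_card_nbhd_ge:
  fixes n M :: nat
  assumes U: "unital n P \<B>" and M: "2 * M = n ^ 4 + n ^ 2"
    and XP: "X \<subseteq> P" and YB: "Y \<subseteq> \<B>" and S: "card X + card Y \<le> M"
    and ne: "X \<noteq> {} \<or> Y \<noteq> {}"
  defines "N \<equiv> card (nbhd (non_incidence_graph P \<B>) (Inl ` X \<union> Inr ` Y))"
  shows "card X + card Y \<le> N \<or> n ^ 3 + 1 \<le> N \<or> n = 2 \<and> 8 \<le> N"
proof -
  let ?C = "{p \<in> P. \<forall>B\<in>Y. p \<in> B}" and ?D = "{B \<in> \<B>. X \<subseteq> B}"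
  define c d where "c = card ?C" and "d = card ?D"
  have n2: "n \<ge> 2" and des: "design2 (n ^ 3 + 1) (n + 1) 1 P \<B>"
    using U by (auto simp: unital_def)
  then have fP: "finite P" and cP: "card P = n ^ 3 + 1"
    and bl: "\<And>B. B \<in> \<B> \<Longrightarrow> B \<subseteq> P \<and> card B = n + 1"
    by (auto simp: design2_def)
  have fB: "finite \<B>" by (rule design2_finite_blocks[OF des])
  have fX: "finite X" and fY: "finite Y" using fP fB XP YB finite_subset by auto
  define s t where "s = card (P - (X \<union> ?C))" and "t = card (\<B> - (Y \<union> ?D))"
  have N: "N = s + t" unfolding N_def s_def t_def
    by (rule card_nbhd_non_incidence_graph[OF fP fB XP YB])
  \<comment> \<open>The bounds \<open>s\<close> and \<open>t\<close> below ignore overlaps; this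
    equation is kept for the exceptional case, where \<open>?C\<close> may lie inside
    \<open>X\<close>.\<close>
  have s_exact: "s + card (X \<union> ?C) = n ^ 3 + 1"
    unfolding s_def using fP XP cP card_mono[of P "X \<union> ?C"]
    by (subst card_Diff_subset) (auto intro: finite_subset)
  have t_exact: "t + card (Y \<union> ?D) = card \<B>"
    unfolding t_def using fB YB card_mono[of \<B> "Y \<union> ?D"]
    by (subst card_Diff_subset) (auto intro: finite_subset)
  have s: "n ^ 3 + 1 \<le> s + (card X + c)"
    using s_exact card_Un_le[of X ?C] by (simp add: c_def)
  have t: "card \<B> \<le> t + (card Y + d)"
    using t_exact card_Un_le[of Y ?D] by (simp add: d_def)
  have b: "card \<B> + n ^ 3 = n ^ 4 + n ^ 2" by (rule unital_card_blocks[OF U])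
  have n3: "n ^ 3 \<ge> 2 * n ^ 2" and n4: "n ^ 4 \<ge> 2 * n ^ 3" and nn: "n ^ 2 \<ge> 2 * n"
    using n2 by (simp_all add: power2_eq_square power3_eq_cube power4_eq_xxxx)
  have n4': "n ^ 4 \<ge> 3 * n ^ 3" "n ^ 3 \<ge> 3 * n ^ 2" "n ^ 2 \<ge> 3 * n" if "n \<ge> 3"
    using that by (simp_all add: power2_eq_square power3_eq_cube power4_eq_xxxx)
  have d2: "d \<le> 1" if "card X \<ge> 2"
    unfolding d_def by (rule linear_space_blocks_through_pair[OF des XP that])
  have c2: "c \<le> 1" if "card Y \<ge> 2"
    unfolding c_def by (rule linear_space_points_on_pair[OF des YB that])
  have xv: "card X \<le> n ^ 3 + 1" using card_mono[OF fP XP] cP by simp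
  have yr: "card Y \<le> n ^ 2" if "q \<in> ?C" for q
    using unital_common_points_few_blocks[OF U YB, of q] that by simp
  consider "card X = 0" | "card X = 1" | "card X \<ge> 2" by linarith
  then show ?thesis
  proof cases
    case 1
    then have X: "X = {}" using fX by simp
    then have "Y \<noteq> {}" using ne by simp
    then have "card Y \<noteq> 0" using fY by simp
    then consider "card Y = 1" | "card Y \<ge> 2" by linarith
    then show ?thesis
    proof cases
      case 1
      then obtain B where B: "Y = {B}" by (auto simp: card_1_singleton_iff)
      then have "?C = B" using bl YB by auto
      then have "c = n + 1" using bl B YB by (simp add: c_def)
      \<comment> \<open>The n^3 - n points off \<open>B\<close> are neighbours, and \<open>S\<close>
        has one element.\<close>
      then show ?thesis using s N X 1 n3 nn n2 by simp
    next
      case 2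
      then have c: "c \<le> 1" by (rule c2)
      show ?thesis
      proof (cases "?C = {}")
        case True
        then have "c = 0" by (simp only: c_def card.empty)
        then show ?thesis using s N X by simp
      next
        case False
        then have "card Y \<le> n ^ 2" using yr by blast
        then show ?thesis using s N X c n3 by simp
      qed
    qed
  next
    case 2
    then obtain p where p: "X = {p}" by (auto simp: card_1_singleton_iff)
    then have d: "d = n ^ 2" using unital_replication[OF U, of p] XP by (simp add: d_def)
    consider "card Y \<le> 1" | "card Y \<ge> 2" by linarith
    then show ?thesis
    proof cases
      case 1
      \<comment> \<open>At least n^4 - n^3 - 1 blocks remain, while \<open>S\<close> has at most two
        elements.\<close>
      then show ?thesis using t d b N 2 n4 n3 nn n2 by simp
    next
      case Y2: 2
      then have c: "c \<le> 1" by (rule c2)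
      show ?thesis
      proof (cases "n = 2")
        case True
        show ?thesis
        proof (cases "?C \<subseteq> X")
          case True
          \<comment> \<open>Here \<open>t\<close> may be 0, so only the 8 points other than
            \<open>p\<close> are counted.\<close>
          then have "X \<union> ?C = X" by auto
          then show ?thesis using s_exact 2 N \<open>n = 2\<close> by simp
        next
          case False
          then have "card Y \<le> n ^ 2" using yr by blast
          then show ?thesis using s t c d b N 2 True by simp
        qed
      next
        case False
        then have "n \<ge> 3" using n2 by simp
        \<comment> \<open>Since \<open>card Y\<close> is below \<open>M\<close>, at least two blocks
          are neighbours; they make up for the at most two points lost in \<open>s\<close>.\<close>
        from n4'[OF this] this show ?thesis using s t c d b N 2 S M by simp
      qed
    qed
  next
    case 3
    then have d: "d \<le> 1" by (rule d2)
    consider "card Y \<le> 1" | "card Y \<ge> 2" by linarith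
    then show ?thesis
    proof cases
      case 1
      then show ?thesis using t d b N xv n4 n3 nn n2 by simp
    next
      case 2
      then have c: "c \<le> 1" by (rule c2)
      \<comment> \<open>Of the 2M + 1 vertices, only \<open>S\<close> and at most two others are
        lost, so \<open>N\<close> is at least M - 1, which is at least n^3 + 1, with equality for n
        = 2.\<close>
      show ?thesis using s t c d b N S M n4 nn n2 by simp
    qed
  qed
qed

section \<open>The isoperimetric number\<close>

theorem theorem1p6:
  fixes n :: nat and P :: "'a set" and \<B> :: "'a set set"
  assumes "n \<ge> 2" and "unital n P \<B>"
  shows "isoperimetric_number (non_incidence_graph P \<B>) =
    (if n = 2 then 4 / 5
     else 2 * (real n ^ 3 + 1) / (real n ^ 2 * (real n ^ 2 + 1)))"
proof -
  let ?G = "non_incidence_graph P \<B>"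
  let ?R = "{real (card (nbhd ?G S)) / real (card S) | S.
            S \<noteq> {} \<and> S \<subseteq> pverts ?G \<and> real (card S) \<le> real (card (pverts ?G)) / 2}"
  note U = assms(2)
  have des: "design2 (n ^ 3 + 1) (n + 1) 1 P \<B>" using U by (auto simp: unital_def)
  then have fP: "finite P" and cP: "card P = n ^ 3 + 1" by (auto simp: design2_def)
  have fB: "finite \<B>" by (rule design2_finite_blocks[OF des])
  have b: "card \<B> + n ^ 3 = n ^ 4 + n ^ 2" by (rule unital_card_blocks[OF U])
  have "even (n ^ 4 + n ^ 2)" by simp
  then obtain M where M: "2 * M = n ^ 4 + n ^ 2" by (metis dvdE)
  have V: "pverts ?G = Inl ` P \<union> Inr ` \<B>" by (simp add: non_incidence_graph_def)
  have cV: "card (pverts ?G) = 2 * M + 1"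
    unfolding V card_Plus_image[OF fP fB] using cP b M by simp
  have fV: "finite (pverts ?G)" using fP fB V by simp
  have n3: "n ^ 3 \<ge> 2 * n ^ 2" and n4: "n ^ 4 \<ge> 2 * n ^ 3" and nn: "n ^ 2 \<ge> 2 * n"
    using assms(1) by (simp_all add: power2_eq_square power3_eq_cube power4_eq_xxxx)
  \<comment> \<open>The value sought is c/M; for n = 2 it is 8/10.\<close>
  define c where "c = (if n = 2 then 8 else n ^ 3 + 1)"
  have c_le: "c \<le> n ^ 3 + 1" "n = 2 \<Longrightarrow> c \<le> 8" by (auto simp: c_def)
  have cM: "c \<le> M" using c_le(1) M n4 nn assms(1) by simp
  have M0: "M > 0" using M nn assms(1) by simp
  have lower: "real c / real M \<le> real (card (nbhd ?G S)) / real (card S)"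
    if S: "S \<noteq> {}" "S \<subseteq> pverts ?G" "real (card S) \<le> real (card (pverts ?G)) / 2" for S
  proof -
    define X Y where "X = {p. Inl p \<in> S}" and "Y = {B. Inr B \<in> S}"
    have SXY: "S = Inl ` X \<union> Inr ` Y"
    proof (rule set_eqI)
      show "u \<in> S \<longleftrightarrow> u \<in> Inl ` X \<union> Inr ` Y" for u by (cases u) (auto simp: X_def Y_def)
    qed
    have XP: "X \<subseteq> P" and YB: "Y \<subseteq> \<B>" using S(2) V by (auto simp: X_def Y_def)
    then have cS: "card S = card X + card Y"
      unfolding SXY using fP fB by (intro card_Plus_image) (auto intro: finite_subset)
    \<comment> \<open>The number of vertices is odd, so half of it rounds down to
      \<open>M\<close>.\<close>
    have SM: "card S \<le> M" using S(3) cV by linarith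
    have S0: "card S > 0" using S fV by (auto simp: card_gt_0_iff intro: finite_subset)
    let ?N = "card (nbhd ?G S)"
    have "card X + card Y \<le> ?N \<or> n ^ 3 + 1 \<le> ?N \<or> n = 2 \<and> 8 \<le> ?N"
      unfolding SXY
      by (rule unital_card_nbhd_ge[OF U M XP YB]) (use SM cS S(1) SXY in auto)
    then have "card S \<le> ?N \<or> c \<le> ?N" using cS c_le by auto
    \<comment> \<open>Each alternative multiplies two inequalities: the first uses
      \<open>cM\<close>, the second \<open>SM\<close>.\<close>
    then have "c * card S \<le> ?N * M"
    proof
      assume "card S \<le> ?N"
      then show ?thesis using mult_le_mono[OF cM] by (metis mult.commute)
    qed (use SM in \<open>auto intro: mult_le_mono\<close>)
    then have "real c * real (card S) \<le> real ?N * real M" by (metis of_nat_le_iff of_nat_mult)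
    then show ?thesis using M0 S0 by (simp add: divide_simps mult.commute)
  qed
  have attained: "real c / real M \<in> ?R"
  proof -
    have witness: "real c / real M \<in> ?R"
      if "X \<subseteq> P" "Y \<subseteq> \<B>" "card X + card Y = M" "card (nbhd ?G (Inl ` X \<union> Inr ` Y)) = c" for X Y
    proof -
      let ?S = "Inl ` X \<union> Inr ` Y"
      have "card ?S = M"
        using that(3) finite_subset[OF that(1) fP] finite_subset[OF that(2) fB]
        by (simp only: card_Plus_image)
      moreover from this have "?S \<noteq> {}" using M0 by (metis card.empty less_irrefl)
      moreover have "?S \<subseteq> pverts ?G" using that(1,2) V by auto
      ultimately show ?thesis using that(4) cV
        unfolding mem_Collect_eq by (intro exI[of _ ?S]) simp
    qed
    have no_common: "{p \<in> P. \<forall>B\<in>Y. p \<in> B} = {}" if "Y \<subseteq> \<B>" "card Y > n ^ 2" for Y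
      using unital_common_points_few_blocks[OF U that(1)] that(2) by fastforce
    show ?thesis
    proof (cases "n = 2")
      case False
      \<comment> \<open>Any \<open>M\<close> blocks serve: they have no common point, so all points
        are neighbours. No block is one, because every block contains the empty set.\<close>
      have "M \<le> card \<B>" using M b n4 by simp
      then obtain Y where Y: "Y \<subseteq> \<B>" "card Y = M" by (metis obtain_subset_with_card_n)
      have "n ^ 2 < M" using M n3 n4 nn assms(1) by simp
      then have common: "{p \<in> P. \<forall>B\<in>Y. p \<in> B} = {}" using Y by (intro no_common) simp_all
      have "card (nbhd ?G (Inl ` {} \<union> Inr ` Y)) = c"
        unfolding card_nbhd_non_incidence_graph[OF fP fB empty_subsetI Y(1)] common
        using Y(1) cP False by (simp add: c_def Un_absorb1)
      then show ?thesis using Y by (intro witness[of "{}" Y]) auto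
    next
      case True
      obtain p where p: "p \<in> P" using cP by fastforce
      let ?D = "{B \<in> \<B>. p \<in> B}"
      have cD: "card ?D = 4" using unital_replication[OF U p] True by simp
      then have "?D \<noteq> {}" by (metis card.empty zero_neq_numeral)
      then obtain L where L: "L \<in> ?D" by blast
      \<comment> \<open>The 8 blocks avoiding \<open>p\<close>, one block through \<open>p\<close>
        and \<open>p\<close> itself make up M = 10 vertices. Every block is then in \<open>Y\<close>
        or contains \<open>p\<close>, and nine blocks have no common point, so the neighbours are
        the 8 other points.\<close>
      define Y where "Y = insert L (\<B> - ?D)"
      have "card (\<B> - ?D) = card \<B> - card ?D" using fB by (intro card_Diff_subset) auto
      then have "card (\<B> - ?D) = 8" using cD b True by simp
      moreover have "card Y = Suc (card (\<B> - ?D))"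
        unfolding Y_def using L fB by (intro card_insert_disjoint) auto
      ultimately have cY: "card Y = 9" by simp
      have YB: "Y \<subseteq> \<B>" using L by (auto simp: Y_def)
      have blocks: "\<B> - (Y \<union> {B \<in> \<B>. {p} \<subseteq> B}) = {}" by (auto simp: Y_def)
      have common: "{q \<in> P. \<forall>B\<in>Y. q \<in> B} = {}" using YB cY True by (intro no_common) simp_all
      have pP: "{p} \<subseteq> P" using p by simp
      have "card (nbhd ?G (Inl ` {p} \<union> Inr ` Y)) = c"
        unfolding card_nbhd_non_incidence_graph[OF fP fB pP YB] blocks common
        using p cP fP True by (simp add: c_def)
      then show ?thesis using p YB cY M True by (intro witness[of "{p}" Y]) auto
    qed
  qed
  have "isoperimetric_number ?G = real c / real M"
    unfolding isoperimetric_number_def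
  proof (rule Min_eqI)
    show "finite ?R" using cV M0 by (intro isoperimetric_number_ratios[OF fV]) simp
    show "real c / real M \<le> z" if "z \<in> ?R" for z
      using that by (elim CollectE exE conjE) (simp only:, rule lower)
  qed (rule attained)
  also have "\<dots> = (if n = 2 then 4 / 5
     else 2 * (real n ^ 3 + 1) / (real n ^ 2 * (real n ^ 2 + 1)))"
  proof -
    have M': "2 * real M = real n ^ 2 * (real n ^ 2 + 1)"
      using arg_cong[OF M, of real] by (simp add: algebra_simps power2_eq_square power4_eq_xxxx)
    show ?thesis
    proof (cases "n = 2")
      case True
      then show ?thesis using M by (simp add: c_def)
    next
      case False
      then show ?thesis unfolding M'[symmetric] using M0 by (simp add: c_def field_simps)
    qed
  qed
  finally show ?thesis .
qed

end
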